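(* Let $(X,d_\phi)$ be a complete $\phi$-metric space, let $k\in(0,\tfrac12)$, and let $T:X\to X$ be a mapping satisfying $d_\phi(Tx,Ty)\le k\,[d_\phi(x,Tx)+d_\phi(y,Ty)]$ for all $x,y\in X$. Then $T$ has a unique fixed point in $X$.
   Context: Definition ($\phi$-metric space). Let $X$ be a nonempty set. A function $d_\phi:X\times X\to\mathbb{R}_{\ge 0}$ is a $\phi$-metric, and $(X,d_\phi)$ is a $\phi$-metric space, if there is a function $\phi:X\times X\times X\to\mathbb{R}_{\ge 0}$ such that for all $x,y,z\in X$: (d1) $d_\phi(x,y)=0$ if and only if $x=y$; (d2) $d_\phi(x,y)=d_\phi(y,x)$; (d3) $d_\phi(x,y)\le d_\phi(x,z)+d_\phi(z,y)+\phi(x,y,z)$; where $\phi$ satisfies: ($\phi1$) $\phi(x,y,z)=0$ if $x=z$ or $y=z$; ($\phi2$) $\phi(x,y,z)=\phi(y,x,z)$; ($\phi3$) for every $\epsilon>0$ there exists $\delta>0$ such that for all $x,y,z\in X$, $\phi(x,y,z)<\epsilon$ whenever $d_\phi(x,z)<\delta$ or $d_\phi(y,z)<\delta$. A sequence $\{x_n\}$ in $X$ converges to $x\in X$ if $d_\phi(x_n,x)\to 0$ as $n\to\infty$; it is Cauchy if for every $\epsilon>0$ there is $N$ with $d_\phi(x_n,x_m)<\epsilon$ for all $m,n\ge N$. $(X,d_\phi)$ is complete if every Cauchy sequence in $X$ converges to some point of $X$. *)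

theory Defs
  imports Complex_Main
begin

text \<open>
  Spaces are given by an explicit carrier set; all conditions are relativised to it, so the
  values of the distance and of the control function off the carrier are irrelevant.
  Codomain constraints (values in the nonnegative reals) appear as explicit inequalities.
\<close>

definition control_function :: "'a set \<Rightarrow> ('a \<Rightarrow> 'a \<Rightarrow> real) \<Rightarrow> ('a \<Rightarrow> 'a \<Rightarrow> 'a \<Rightarrow> real) \<Rightarrow> bool"
  where "control_function X d \<phi> \<longleftrightarrow>
    (\<forall>x\<in>X. \<forall>y\<in>X. \<forall>z\<in>X. 0 \<le> \<phi> x y z) \<and>
    (\<forall>x\<in>X. \<forall>y\<in>X. \<forall>z\<in>X. x = z \<or> y = z \<longrightarrow> \<phi> x y z = 0) \<and>
    (\<forall>x\<in>X. \<forall>y\<in>X. \<forall>z\<in>X. \<phi> x y z = \<phi> y x z) \<and>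
    (\<forall>\<epsilon>>0. \<exists>\<delta>>0. \<forall>x\<in>X. \<forall>y\<in>X. \<forall>z\<in>X. d x z < \<delta> \<or> d y z < \<delta> \<longrightarrow> \<phi> x y z < \<epsilon>)"

definition phi_metric_space :: "'a set \<Rightarrow> ('a \<Rightarrow> 'a \<Rightarrow> real) \<Rightarrow> bool"
  where "phi_metric_space X d \<longleftrightarrow>
    X \<noteq> {} \<and>
    (\<forall>x\<in>X. \<forall>y\<in>X. 0 \<le> d x y) \<and>
    (\<exists>\<phi>. control_function X d \<phi> \<and>
      (\<forall>x\<in>X. \<forall>y\<in>X. d x y = 0 \<longleftrightarrow> x = y) \<and>
      (\<forall>x\<in>X. \<forall>y\<in>X. d x y = d y x) \<and>
      (\<forall>x\<in>X. \<forall>y\<in>X. \<forall>z\<in>X. d x y \<le> d x z + d z y + \<phi> x y z))"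

definition phi_converges :: "'a set \<Rightarrow> ('a \<Rightarrow> 'a \<Rightarrow> real) \<Rightarrow> (nat \<Rightarrow> 'a) \<Rightarrow> 'a \<Rightarrow> bool"
  where "phi_converges X d s x \<longleftrightarrow>
    (\<forall>n. s n \<in> X) \<and> x \<in> X \<and> (\<lambda>n. d (s n) x) \<longlonglongrightarrow> 0"

definition phi_Cauchy :: "'a set \<Rightarrow> ('a \<Rightarrow> 'a \<Rightarrow> real) \<Rightarrow> (nat \<Rightarrow> 'a) \<Rightarrow> bool"
  where "phi_Cauchy X d s \<longleftrightarrow>
    (\<forall>n. s n \<in> X) \<and> (\<forall>\<epsilon>>0. \<exists>N. \<forall>m\<ge>N. \<forall>n\<ge>N. d (s n) (s m) < \<epsilon>)"

definition complete_phi_metric_space :: "'a set \<Rightarrow> ('a \<Rightarrow> 'a \<Rightarrow> real) \<Rightarrow> bool"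
  where "complete_phi_metric_space X d \<longleftrightarrow>
    phi_metric_space X d \<and> (\<forall>s. phi_Cauchy X d s \<longrightarrow> (\<exists>x. phi_converges X d s x))"

end

theory Submission
  imports Defs
begin

text \<open>
  Along a Picard orbit the step lengths \<open>a n = d (s n) (s (Suc n))\<close> contract by the factor
  \<open>k / (1 - k) < 1\<close>. Since Kannan's condition bounds \<open>d (s (Suc m)) (s (Suc n))\<close> directly by
  \<open>k * (a m + a n)\<close>, the orbit is Cauchy without any appeal to the weakened triangle inequality.
  That inequality is used only once, to compare the limit \<open>x\<close> with \<open>T x\<close>
  through \<open>s (Suc n)\<close>, where the control term vanishes as \<open>s (Suc n)\<close> tends to \<open>x\<close>.
\<close>

text \<open>Nonnegativity bounds the values below; the smallness axiom bounds them above, through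
  its disjunct on the first and third arguments. Only the third argument moves, so \<open>y\<close>
  may stay far from \<open>x\<close>, as \<open>T x\<close> will in the application.\<close>

lemma control_function_tendsto_zero:
  assumes "control_function X d \<phi>" and "x \<in> X" and "y \<in> X" and "\<And>n. s n \<in> X"
    and "(\<lambda>n. d x (s n)) \<longlonglongrightarrow> 0"
  shows "(\<lambda>n. \<phi> x y (s n)) \<longlonglongrightarrow> 0"
proof (rule order_tendstoI)
  fix b :: real
  assume "b < 0"
  moreover have "0 \<le> \<phi> x y (s n)" for n
    using assms(1-4) by (simp add: control_function_def)
  ultimately show "\<forall>\<^sub>F n in sequentially. b < \<phi> x y (s n)"
    by (simp add: less_le_trans)
next
  fix e :: real
  assume "0 < e"
  then obtain \<delta> where "\<delta> > 0"
    and \<delta>: "\<And>z. z \<in> X \<Longrightarrow> d x z < \<delta> \<Longrightarrow> \<phi> x y z < e"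
    using assms(1-3) unfolding control_function_def by meson
  have "\<forall>\<^sub>F n in sequentially. d x (s n) < \<delta>"
    using assms(5) \<open>\<delta> > 0\<close> by (rule order_tendstoD)
  then show "\<forall>\<^sub>F n in sequentially. \<phi> x y (s n) < e"
    by eventually_elim (simp add: \<delta> assms(4))
qed

lemma kannan_orbit_step_tendsto_zero:
  fixes d :: "'a \<Rightarrow> 'a \<Rightarrow> real"
  assumes nonneg: "\<And>x y. x \<in> X \<Longrightarrow> y \<in> X \<Longrightarrow> 0 \<le> d x y"
    and "0 \<le> k" and "k < 1 / 2"
    and kannan: "\<And>x y. x \<in> X \<Longrightarrow> y \<in> X \<Longrightarrow> d (T x) (T y) \<le> k * (d x (T x) + d y (T y))"
    and orbit: "\<And>n. s n \<in> X" "\<And>n. s (Suc n) = T (s n)"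
  shows "(\<lambda>n. d (s n) (s (Suc n))) \<longlonglongrightarrow> 0"
proof -
  define h where "h = k / (1 - k)"
  have h: "0 \<le> h" "h < 1"
    using assms(2,3) by (auto simp: h_def divide_simps)
  have step: "d (s (Suc n)) (s (Suc (Suc n))) \<le> h * d (s n) (s (Suc n))" for n
  proof -
    \<comment> \<open>The new step length occurs on both sides; solving for it produces the factor
      \<open>h\<close>, and \<open>k < 1 / 2\<close> is what makes \<open>h < 1\<close>.\<close>
    have "d (s (Suc n)) (s (Suc (Suc n)))
        \<le> k * (d (s n) (s (Suc n)) + d (s (Suc n)) (s (Suc (Suc n))))"
      using kannan[OF orbit(1)[of n] orbit(1)[of "Suc n"]] by (simp add: orbit(2))
    then show ?thesis
      using assms(3) by (simp add: h_def field_simps)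
  qed
  have bound: "d (s n) (s (Suc n)) \<le> h ^ n * d (s 0) (s (Suc 0))" for n
  proof (induction n)
    case (Suc n)
    then show ?case
      using step[of n] mult_left_mono[OF Suc h(1)] by (simp add: mult.assoc)
  qed simp
  have "(\<lambda>n. h ^ n * d (s 0) (s (Suc 0))) \<longlonglongrightarrow> 0"
    using h by (intro tendsto_mult_left_zero LIMSEQ_realpow_zero)
  then show ?thesis
    \<comment> \<open>The lower bound is the constant 0; \<open>rotated 2\<close> moves the limit of
      the upper bound to the front for the chained fact.\<close>
    by (rule tendsto_sandwich[OF _ _ tendsto_const, rotated 2])
       (auto intro!: always_eventually bound nonneg orbit(1))
qed

lemma kannan_orbit_Cauchy:
  fixes d :: "'a \<Rightarrow> 'a \<Rightarrow> real"
  assumes nonneg: "\<And>x y. x \<in> X \<Longrightarrow> y \<in> X \<Longrightarrow> 0 \<le> d x y"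
    and k: "0 \<le> k" "k < 1 / 2"
    and kannan: "\<And>x y. x \<in> X \<Longrightarrow> y \<in> X \<Longrightarrow> d (T x) (T y) \<le> k * (d x (T x) + d y (T y))"
    and orbit: "\<And>n. s n \<in> X" "\<And>n. s (Suc n) = T (s n)"
  shows "phi_Cauchy X d s"
  unfolding phi_Cauchy_def
proof (intro conjI allI impI)
  fix e :: real
  assume "0 < e"
  have "(\<lambda>n. d (s n) (s (Suc n))) \<longlonglongrightarrow> 0"
    using assms by (rule kannan_orbit_step_tendsto_zero)
  then have "\<forall>\<^sub>F n in sequentially. d (s n) (s (Suc n)) < e"
    using \<open>0 < e\<close> by (rule order_tendstoD)
  then obtain N where N: "\<And>n. n \<ge> N \<Longrightarrow> d (s n) (s (Suc n)) < e"
    unfolding eventually_sequentially by blast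
  \<comment> \<open>The threshold is \<open>Suc N\<close> because Kannan's condition is applied to
    the predecessors of \<open>m\<close> and \<open>n\<close>, which must still be at least
    \<open>N\<close>.\<close>
  have "d (s n) (s m) < e" if "Suc N \<le> m" "Suc N \<le> n" for m n
  proof -
    obtain m' n' where eq: "m = Suc m'" "n = Suc n'" and le: "N \<le> m'" "N \<le> n'"
      using \<open>Suc N \<le> m\<close> \<open>Suc N \<le> n\<close> by (auto dest!: Suc_le_D)
    have "d (s n) (s m) \<le> k * (d (s n') (s (Suc n')) + d (s m') (s (Suc m')))"
      using kannan[of "s n'" "s m'"] orbit eq by simp
    also have "\<dots> \<le> k * (e + e)"
      using N[OF le(1)] N[OF le(2)] k(1) by (intro mult_left_mono add_mono) auto
    \<comment> \<open>Since \<open>2 * k < 1\<close>, bounding each step by \<open>e\<close> itself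
      suffices.\<close>
    also have "\<dots> < e"
      using k(2) \<open>0 < e\<close> by simp
    finally show ?thesis .
  qed
  then show "\<exists>N. \<forall>m\<ge>N. \<forall>n\<ge>N. d (s n) (s m) < e"
    by blast
qed (rule orbit(1))

theorem theorem5p4:
  fixes X :: "'a set" and d :: "'a \<Rightarrow> 'a \<Rightarrow> real" and T :: "'a \<Rightarrow> 'a" and k :: real
  assumes "complete_phi_metric_space X d"
    and "0 < k" and "k < 1 / 2"
    and "\<And>x. x \<in> X \<Longrightarrow> T x \<in> X"
    and "\<And>x y. x \<in> X \<Longrightarrow> y \<in> X \<Longrightarrow> d (T x) (T y) \<le> k * (d x (T x) + d y (T y))"
  shows "\<exists>!x. x \<in> X \<and> T x = x"
proof -
  note T = assms(4) and kannan = assms(5)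
  have space: "phi_metric_space X d"
    and complete: "\<And>s. phi_Cauchy X d s \<Longrightarrow> \<exists>x. phi_converges X d s x"
    using assms(1) by (auto simp: complete_phi_metric_space_def)
  have nonneg: "0 \<le> d x y" if "x \<in> X" "y \<in> X" for x y
    using space that by (simp add: phi_metric_space_def)
  obtain \<phi> where \<phi>: "control_function X d \<phi>"
    and zero: "\<And>x y. x \<in> X \<Longrightarrow> y \<in> X \<Longrightarrow> d x y = 0 \<longleftrightarrow> x = y"
    and sym: "\<And>x y. x \<in> X \<Longrightarrow> y \<in> X \<Longrightarrow> d x y = d y x"
    and triangle: "\<And>x y z. x \<in> X \<Longrightarrow> y \<in> X \<Longrightarrow> z \<in> X \<Longrightarrow> d x y \<le> d x z + d z y + \<phi> x y z"
    using space unfolding phi_metric_space_def by blast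
  obtain x0 where "x0 \<in> X"
    using space by (auto simp: phi_metric_space_def)
  define s where "s n = (T ^^ n) x0" for n
  have s_Suc: "s (Suc n) = T (s n)" for n
    by (simp add: s_def)
  have s_in: "s n \<in> X" for n
    by (induction n) (auto simp: s_def \<open>x0 \<in> X\<close> T)
  have "phi_Cauchy X d s"
    using nonneg less_imp_le[OF assms(2)] assms(3) kannan s_in s_Suc by (rule kannan_orbit_Cauchy)
  then obtain x where x: "x \<in> X" and conv: "(\<lambda>n. d (s n) x) \<longlonglongrightarrow> 0"
    using complete by (auto simp: phi_converges_def)
  have lim: "(\<lambda>n. d x (s (Suc n))) \<longlonglongrightarrow> 0"
    unfolding sym[OF x s_in] using conv by (rule LIMSEQ_Suc)
  have steps: "(\<lambda>n. d (s n) (s (Suc n))) \<longlonglongrightarrow> 0"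
    using nonneg less_imp_le[OF assms(2)] assms(3) kannan s_in s_Suc
    by (rule kannan_orbit_step_tendsto_zero)
  \<comment> \<open>Kannan's condition bounds \<open>d (T (s n)) (T x)\<close> by a sum containing
    \<open>k * d x (T x)\<close>; moving that term to the left leaves a left side independent of
    \<open>n\<close>, ready for the limit.\<close>
  have "(1 - k) * d x (T x)
      \<le> d x (s (Suc n)) + k * d (s n) (s (Suc n)) + \<phi> x (T x) (s (Suc n))" for n
    using triangle[OF x T[OF x] s_in[of "Suc n"]] kannan[OF s_in[of n] x]
    by (simp add: s_Suc algebra_simps)
  moreover have "(\<lambda>n. d x (s (Suc n)) + k * d (s n) (s (Suc n)) + \<phi> x (T x) (s (Suc n)))
      \<longlonglongrightarrow> 0"
    by (intro tendsto_add_zero lim tendsto_mult_right_zero steps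
        control_function_tendsto_zero[OF \<phi> x T[OF x] s_in lim])
  ultimately have "(1 - k) * d x (T x) \<le> 0"
    by (intro LIMSEQ_le_const) auto
  then have "d x (T x) = 0"
    using nonneg[OF x T[OF x]] assms(3) by (simp add: mult_le_0_iff)
  then have fixed: "T x = x"
    using zero[OF x T[OF x]] by simp
  have "y = x" if "y \<in> X" "T y = y" for y
  proof -
    \<comment> \<open>At two fixed points the right side of Kannan's condition consists of
      self-distances only.\<close>
    have "d y x \<le> k * (d y y + d x x)"
      using kannan[OF \<open>y \<in> X\<close> x] \<open>T y = y\<close> fixed by simp
    also have "\<dots> = 0"
      using zero[of x x] zero[of y y] x \<open>y \<in> X\<close> by simp
    finally show ?thesis
      using nonneg[of y x] zero[of y x] x \<open>y \<in> X\<close> by simp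
  qed
  with x fixed show ?thesis
    by blast
qed

end
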